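(* Let $\omega=-\frac12+i\frac{\sqrt3}{2}$. The matrix $$Q=\begin{pmatrix} 0 & 1 & 1 & 1 & 1 & 1 & 1 & 1 & 1 \\ 1 & 0 & 1 & \omega & \omega & \omega & \omega^2 & \omega^2 & \omega^2 \\ 1 & 1 & 0 & \omega^2 & \omega^2 & \omega^2 & \omega & \omega & \omega \\ 1 & \omega^2 & \omega & 0 & \omega & \omega^2 & 1 & \omega & \omega^2 \\ 1 & \omega^2 & \omega & \omega^2 & 0 & \omega & \omega & \omega^2 & 1 \\ 1 & \omega^2 & \omega & \omega & \omega^2 & 0 & \omega^2 & 1 & \omega \\ 1 & \omega & \omega^2 & 1 & \omega^2 & \omega & 0 & \omega^2 & \omega \\ 1 & \omega & \omega^2 & \omega^2 & \omega & 1 & \omega & 0 & \omega^2 \\ 1 & \omega & \omega^2 & \omega & 1 & \omega^2 & \omega^2 & \omega & 0 \end{pmatrix}$$ is a $9\times9$ nontrivial cube root signature matrix of an equiangular $(9,6)$-frame. Furthermore, any $9\times 9$ nontrivial cube root signature matrix of an equiangular $(9,6)$-frame is switching equivalent to $Q$.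
   Context: An $(n,k)$-frame is a family $\{f_1,\dots,f_n\}$ in $\mathbb{C}^k$ with $\sum_{j}|\langle x,f_j\rangle|^2=\|x\|^2$ for all $x\in\mathbb{C}^k$ (a Parseval frame). It is equiangular if all $f_i$ are non-zero and $|\langle f_i/\|f_i\|,f_j/\|f_j\|\rangle|$ is the same constant for all $i\ne j$. A Seidel matrix is a self-adjoint complex matrix with zero diagonal and off-diagonal entries of modulus one. An $n\times n$ Seidel matrix $Q$ is the signature matrix of an equiangular $(n,k)$-frame if there is an equiangular $(n,k)$-frame $\{f_1,\dots,f_n\}$ with $(\langle f_j,f_i\rangle)_{i,j}=\frac kn I_n+c_{n,k}Q$, where $c_{n,k}=\sqrt{\frac{k(n-k)}{n^2(n-1)}}$. A cube root Seidel matrix is a Seidel matrix all of whose off-diagonal entries are cube roots of unity; if it has exactly two distinct eigenvalues it is called a cube root signature matrix. Two Seidel matrices are switching equivalent if one is obtained from the other by conjugation with a diagonal unitary matrix and a permutation matrix. A Seidel matrix is in standard form if its first row and first column contain only $1$'s except on the diagonal; every Seidel matrix is switching equivalent to one in standard form (a standard form of it). It is trivial if it has a standard form with all off-diagonal entries equal to $1$, and nontrivial if its standard form has at least one off-diagonal entry not equal to $1$. *)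

theory Defs
  imports
    "HOL-Analysis.L2_Norm"
    "Jordan_Normal_Form.Schur_Decomposition"
    "Jordan_Normal_Form.Spectral_Radius"
begin

text \<open>Vectors of $\mathbb{C}^k$ are elements of \<^term>\<open>carrier_vec k\<close>. The inner product
  $\langle x, y\rangle$ is \<^term>\<open>x \<bullet>c y\<close>, linear in the first and conjugate-linear in the
  second argument. Families and matrices are indexed from 0: $f_1,\dots,f_n$ are the values
  of \<open>f\<close> at \<open>0, \<dots>, n - 1\<close>.\<close>

definition cvec_norm :: "complex vec \<Rightarrow> real" where
  "cvec_norm x = L2_set (\<lambda>i. cmod (x $ i)) {..<dim_vec x}"

definition parseval_frame :: "nat \<Rightarrow> nat \<Rightarrow> (nat \<Rightarrow> complex vec) \<Rightarrow> bool" where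
  "parseval_frame n k f \<longleftrightarrow>
     (\<forall>j<n. f j \<in> carrier_vec k) \<and>
     (\<forall>x\<in>carrier_vec k. (\<Sum>j<n. (cmod (x \<bullet>c f j))\<^sup>2) = (cvec_norm x)\<^sup>2)"

definition cvec_normalize :: "complex vec \<Rightarrow> complex vec" where
  "cvec_normalize x = complex_of_real (1 / cvec_norm x) \<cdot>\<^sub>v x"

definition equiangular_frame :: "nat \<Rightarrow> nat \<Rightarrow> (nat \<Rightarrow> complex vec) \<Rightarrow> bool" where
  "equiangular_frame n k f \<longleftrightarrow>
     parseval_frame n k f \<and>
     (\<forall>i<n. f i \<noteq> 0\<^sub>v k) \<and>
     (\<exists>c. \<forall>i<n. \<forall>j<n. i \<noteq> j \<longrightarrow>
        cmod (cvec_normalize (f i) \<bullet>c cvec_normalize (f j)) = c)"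

definition seidel_matrix :: "nat \<Rightarrow> complex mat \<Rightarrow> bool" where
  "seidel_matrix n Q \<longleftrightarrow>
     Q \<in> carrier_mat n n \<and>
     mat_adjoint Q = Q \<and>
     (\<forall>i<n. Q $$ (i, i) = 0) \<and>
     (\<forall>i<n. \<forall>j<n. i \<noteq> j \<longrightarrow> cmod (Q $$ (i, j)) = 1)"

definition signature_const :: "nat \<Rightarrow> nat \<Rightarrow> real" where
  "signature_const n k =
     sqrt (real k * (real n - real k) / ((real n)\<^sup>2 * (real n - 1)))"

definition signature_matrix_of_frame :: "nat \<Rightarrow> nat \<Rightarrow> complex mat \<Rightarrow> bool" where
  "signature_matrix_of_frame n k Q \<longleftrightarrow>
     seidel_matrix n Q \<and>
     (\<exists>f. equiangular_frame n k f \<and>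
        mat n n (\<lambda>(i, j). f j \<bullet>c f i) =
          complex_of_real (real k / real n) \<cdot>\<^sub>m 1\<^sub>m n
          + complex_of_real (signature_const n k) \<cdot>\<^sub>m Q)"

definition cube_root_seidel_matrix :: "nat \<Rightarrow> complex mat \<Rightarrow> bool" where
  "cube_root_seidel_matrix n Q \<longleftrightarrow>
     seidel_matrix n Q \<and>
     (\<forall>i<n. \<forall>j<n. i \<noteq> j \<longrightarrow> (Q $$ (i, j)) ^ 3 = 1)"

definition cube_root_signature_matrix :: "nat \<Rightarrow> complex mat \<Rightarrow> bool" where
  "cube_root_signature_matrix n Q \<longleftrightarrow>
     cube_root_seidel_matrix n Q \<and> card (spectrum Q) = 2"

definition unitary_mat :: "nat \<Rightarrow> complex mat \<Rightarrow> bool" where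
  "unitary_mat n U \<longleftrightarrow>
     U \<in> carrier_mat n n \<and> U * mat_adjoint U = 1\<^sub>m n \<and> mat_adjoint U * U = 1\<^sub>m n"

definition permutation_mat :: "nat \<Rightarrow> complex mat \<Rightarrow> bool" where
  "permutation_mat n P \<longleftrightarrow>
     (\<exists>p. p permutes {..<n} \<and> P = mat n n (\<lambda>(i, j). if i = p j then 1 else 0))"

definition switching_equivalent :: "nat \<Rightarrow> complex mat \<Rightarrow> complex mat \<Rightarrow> bool" where
  "switching_equivalent n A B \<longleftrightarrow>
     A \<in> carrier_mat n n \<and> B \<in> carrier_mat n n \<and>
     (\<exists>D P. diagonal_mat D \<and> unitary_mat n D \<and> permutation_mat n P \<and>
        B = P * (D * A * mat_adjoint D) * mat_adjoint P)"

definition standard_form :: "nat \<Rightarrow> complex mat \<Rightarrow> bool" where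
  "standard_form n S \<longleftrightarrow>
     seidel_matrix n S \<and>
     (\<forall>i<n. i \<noteq> 0 \<longrightarrow> S $$ (0, i) = 1 \<and> S $$ (i, 0) = 1)"

definition standard_form_of :: "nat \<Rightarrow> complex mat \<Rightarrow> complex mat \<Rightarrow> bool" where
  "standard_form_of n Q S \<longleftrightarrow> standard_form n S \<and> switching_equivalent n Q S"

text \<open>A standard form is in general only unique up to further switching, but whether all its
  off-diagonal entries are 1 does not depend on the choice. Quantifying existentially over
  the standard forms of a Seidel matrix \<open>Q\<close> is therefore the same as quantifying universally.\<close>

definition nontrivial_seidel :: "nat \<Rightarrow> complex mat \<Rightarrow> bool" where
  "nontrivial_seidel n Q \<longleftrightarrow>
     (\<exists>S. standard_form_of n Q S \<and> (\<exists>i<n. \<exists>j<n. i \<noteq> j \<and> S $$ (i, j) \<noteq> 1))"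

definition nontrivial_cube_root_signature_matrix_of_frame ::
    "nat \<Rightarrow> nat \<Rightarrow> complex mat \<Rightarrow> bool" where
  "nontrivial_cube_root_signature_matrix_of_frame n k Q \<longleftrightarrow>
     cube_root_signature_matrix n Q \<and> nontrivial_seidel n Q \<and> signature_matrix_of_frame n k Q"

definition omega :: complex  (\<open>\<omega>\<close>) where
  "\<omega> = - 1 / 2 + \<i> * complex_of_real (sqrt 3 / 2)"

definition Q9 :: "complex mat" where
  "Q9 = mat_of_rows_list 9
    [[0, 1,   1,   1,   1,   1,   1,   1,   1  ],
     [1, 0,   1,   \<omega>,   \<omega>,   \<omega>,   \<omega>^2, \<omega>^2, \<omega>^2],
     [1, 1,   0,   \<omega>^2, \<omega>^2, \<omega>^2, \<omega>,   \<omega>,   \<omega>  ],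
     [1, \<omega>^2, \<omega>,   0,   \<omega>,   \<omega>^2, 1,   \<omega>,   \<omega>^2],
     [1, \<omega>^2, \<omega>,   \<omega>^2, 0,   \<omega>,   \<omega>,   \<omega>^2, 1  ],
     [1, \<omega>^2, \<omega>,   \<omega>,   \<omega>^2, 0,   \<omega>^2, 1,   \<omega>  ],
     [1, \<omega>,   \<omega>^2, 1,   \<omega>^2, \<omega>,   0,   \<omega>^2, \<omega>  ],
     [1, \<omega>,   \<omega>^2, \<omega>^2, \<omega>,   1,   \<omega>,   0,   \<omega>^2],
     [1, \<omega>,   \<omega>^2, \<omega>,   1,   \<omega>^2, \<omega>^2, \<omega>,   0  ]]"

end

theory Submission
  imports Defs
begin

text \<open>For a \<open>(9, 6)\<close>-frame the Gram matrix \<open>(4 I + Q) / 6\<close> is a projection, so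
  \<open>Q\<^sup>2 = 8 I - 2 Q\<close>. Off the diagonal this says that, for \<open>i \<noteq> j\<close>, the seven cube roots
  of unity \<open>Q\<^sub>i\<^sub>k Q\<^sub>k\<^sub>j Q\<^sub>j\<^sub>i\<close> sum to \<open>-2\<close>, which forces exactly one of them to be 1 and three
  to be \<open>\<omega>\<close>. After normalising the first row to 1, every \<open>i \<noteq> 0\<close> therefore has a unique
  partner \<open>i'\<close> with entry 1 at \<open>(i, i')\<close>, and replacing an index by its partner inverts the entries. If
  \<open>x, y, z\<close> are the three indices \<open>k\<close> with \<open>Q\<^sub>a\<^sub>k = \<omega>\<close>, the same condition makes the entries among
  \<open>x, y, z\<close> a cyclic tournament, so the order \<open>0, a, a', x, y, z, x', z', y'\<close> reproduces the
  given matrix. Conversely the given matrix is realised by an explicit frame.\<close>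

section \<open>Parseval frames and signature matrices\<close>

lemma mat_adjoint_index:
  "i < dim_col A \<Longrightarrow> j < dim_row A \<Longrightarrow> mat_adjoint A $$ (i, j) = conjugate (A $$ (j, i))"
  by (simp add: mat_adjoint_def mat_of_rows_def)

lemma mat_adjoint_carrier: "A \<in> carrier_mat n m \<Longrightarrow> mat_adjoint A \<in> carrier_mat m n"
  by (auto simp: mat_adjoint_def)

lemma cscalar_prod_sum: "dim_vec y = n \<Longrightarrow> x \<bullet>c y = (\<Sum>i<n. x $ i * cnj (y $ i))"
  by (auto simp: scalar_prod_def conjugate_vec_def lessThan_atLeast0 intro!: sum.cong)

lemma of_real_cmod_sq: "(complex_of_real (cmod z))\<^sup>2 = z * cnj z"
  by (metis complex_norm_square of_real_power)

lemma cvec_norm_sq: "complex_of_real ((cvec_norm x)\<^sup>2) = x \<bullet>c x"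
  by (simp add: cvec_norm_def L2_set_def sum_nonneg cscalar_prod_sum[of x "dim_vec x"]
      of_real_cmod_sq)

lemma cscalar_prod_conj:
  "x \<in> carrier_vec k \<Longrightarrow> y \<in> carrier_vec k \<Longrightarrow> cnj (x \<bullet>c y) = y \<bullet>c x"
  by (simp add: cscalar_prod_sum[of _ k] mult.commute)

lemma cscalar_prod_add_smult:
  assumes "x \<in> carrier_vec k" "y \<in> carrier_vec k" "z \<in> carrier_vec k"
  shows "(x + t \<cdot>\<^sub>v y) \<bullet>c z = x \<bullet>c z + t * (y \<bullet>c z)"
    and "z \<bullet>c (x + t \<cdot>\<^sub>v y) = z \<bullet>c x + cnj t * (z \<bullet>c y)"
  using assms
  by (simp_all add: cscalar_prod_sum[of _ k] algebra_simps sum.distrib sum_distrib_left)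

text \<open>The defect \<open>g\<close> is sesquilinear, and the Parseval identity makes it vanish
  on the diagonal. Expanding it at \<open>x + y\<close> and at \<open>x + \<i> y\<close> gives
  \<open>g x y + g y x = 0\<close> and \<open>g y x - g x y = 0\<close>, so it vanishes
  everywhere.\<close>

lemma parseval_frame_polarized:
  assumes f: "parseval_frame n k f" and x: "x \<in> carrier_vec k" and y: "y \<in> carrier_vec k"
  shows "(\<Sum>j<n. (x \<bullet>c f j) * (f j \<bullet>c y)) = x \<bullet>c y"
proof -
  have fc: "f j \<in> carrier_vec k" if "j < n" for j
    using f that by (auto simp: parseval_frame_def)
  define g where "g u v = (\<Sum>j<n. (u \<bullet>c f j) * (f j \<bullet>c v)) - u \<bullet>c v" for u v
  have diag: "g u u = 0" if u: "u \<in> carrier_vec k" for u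
  proof -
    have "(\<Sum>j<n. (u \<bullet>c f j) * (f j \<bullet>c u)) = (\<Sum>j<n. complex_of_real ((cmod (u \<bullet>c f j))\<^sup>2))"
      using fc u by (intro sum.cong refl) (auto simp: of_real_cmod_sq cscalar_prod_conj[of _ k])
    also have "\<dots> = complex_of_real ((cvec_norm u)\<^sup>2)"
      using f u by (simp only: parseval_frame_def of_real_sum[symmetric])
    finally show ?thesis by (simp add: g_def cvec_norm_sq del: of_real_power)
  qed
  have expand: "g (x + t \<cdot>\<^sub>v y) (x + t \<cdot>\<^sub>v y) = g x x + cnj t * g x y + t * g y x + t * cnj t * g y y"
    for t
  proof -
    have "(\<Sum>j<n. ((x + t \<cdot>\<^sub>v y) \<bullet>c f j) * (f j \<bullet>c (x + t \<cdot>\<^sub>v y))) =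
      (\<Sum>j<n. ((x \<bullet>c f j) + t * (y \<bullet>c f j)) * ((f j \<bullet>c x) + cnj t * (f j \<bullet>c y)))"
      using fc x y by (intro sum.cong refl) (simp add: cscalar_prod_add_smult[of _ k])
    moreover have "(x + t \<cdot>\<^sub>v y) \<bullet>c (x + t \<cdot>\<^sub>v y) =
      x \<bullet>c x + cnj t * (x \<bullet>c y) + t * ((y \<bullet>c x) + cnj t * (y \<bullet>c y))"
      using x y by (simp add: cscalar_prod_add_smult[of _ k] algebra_simps)
    ultimately show ?thesis
      by (simp add: g_def algebra_simps sum.distrib sum_distrib_left)
  qed
  have "g x y + g y x = 0" "g y x - g x y = 0"
    using expand[of 1] expand[of \<i>] diag x y by (simp_all add: algebra_simps)
  then have "g x y = 0"
    by (simp add: algebra_simps)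
  then show ?thesis by (simp add: g_def)
qed

text \<open>Orthonormality of the coordinate columns says that the map sending \<open>x\<close> to
  its frame coefficients is an isometry. This turns the frame property into a finite check.\<close>

lemma parseval_frameI:
  assumes fc: "\<And>j. j < n \<Longrightarrow> f j \<in> carrier_vec k"
    and orth: "\<And>c d. c < k \<Longrightarrow> d < k \<Longrightarrow>
      (\<Sum>j<n. cnj (f j $ c) * f j $ d) = (if c = d then 1 else 0)"
  shows "parseval_frame n k f"
  unfolding parseval_frame_def
proof (intro conjI allI impI ballI fc)
  fix x :: "complex vec" assume x: "x \<in> carrier_vec k"
  have "complex_of_real (\<Sum>j<n. (cmod (x \<bullet>c f j))\<^sup>2) = (\<Sum>j<n. (x \<bullet>c f j) * (f j \<bullet>c x))"
    unfolding of_real_sum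
    using fc x by (intro sum.cong refl) (auto simp: of_real_cmod_sq cscalar_prod_conj[of _ k])
  also have "\<dots> = (\<Sum>j<n. \<Sum>c<k. \<Sum>d<k. x $ c * cnj (x $ d) * (cnj (f j $ c) * f j $ d))"
    using fc x by (intro sum.cong refl)
      (simp add: cscalar_prod_sum[of _ k] sum_product mult_ac)
  also have "\<dots> = (\<Sum>c<k. \<Sum>d<k. x $ c * cnj (x $ d) * (\<Sum>j<n. cnj (f j $ c) * f j $ d))"
    by (subst sum.swap, rule sum.cong[OF refl], subst sum.swap, simp add: sum_distrib_left)
  also have "\<dots> = (\<Sum>c<k. \<Sum>d<k. if c = d then x $ c * cnj (x $ d) else 0)"
    by (intro sum.cong refl) (simp add: orth)
  also have "\<dots> = x \<bullet>c x"
    using x by (simp add: cscalar_prod_sum[of _ k])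
  finally show "(\<Sum>j<n. (cmod (x \<bullet>c f j))\<^sup>2) = (cvec_norm x)\<^sup>2"
    by (simp only: cvec_norm_sq[symmetric] of_real_eq_iff)
qed

text \<open>At the frame vectors themselves the polarized identity is the entrywise form of
  \<open>G * G = G\<close> for the Gram matrix.\<close>

lemma signature_matrix_square:
  assumes "signature_matrix_of_frame 9 6 A"
  shows "A * A = 8 \<cdot>\<^sub>m 1\<^sub>m 9 - 2 \<cdot>\<^sub>m A"
proof -
  obtain f where f: "equiangular_frame 9 6 f" and A: "A \<in> carrier_mat 9 9"
    and gram: "mat 9 9 (\<lambda>(i, j). f j \<bullet>c f i) =
          complex_of_real (real 6 / real 9) \<cdot>\<^sub>m 1\<^sub>m 9
          + complex_of_real (signature_const 9 6) \<cdot>\<^sub>m A"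
    using assms by (auto simp: signature_matrix_of_frame_def seidel_matrix_def)
  \<comment> \<open>Here \<open>k (n - k) / (n^2 (n - 1))\<close> is 18 / 648 = 1 / 36.\<close>
  have c: "signature_const 9 6 = 1 / 6"
    by (simp add: signature_const_def real_sqrt_divide)
  have G: "f j \<bullet>c f i = (if i = j then 2 / 3 else 0) + A $$ (i, j) / 6" if "i < 9" "j < 9" for i j
    using arg_cong[OF gram, of "\<lambda>M. M $$ (i, j)"] A that by (simp add: c)
  have p: "parseval_frame 9 6 f" using f by (simp add: equiangular_frame_def)
  have fc: "f j \<in> carrier_vec 6" if "j < 9" for j
    using p that by (auto simp: parseval_frame_def)
  show ?thesis
  proof (rule eq_matI)
    fix i j assume "i < dim_row (8 \<cdot>\<^sub>m 1\<^sub>m 9 - 2 \<cdot>\<^sub>m A)" "j < dim_col (8 \<cdot>\<^sub>m 1\<^sub>m 9 - 2 \<cdot>\<^sub>m A)"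
    then have i: "i < 9" and j: "j < 9" using A by auto
    have "f j \<bullet>c f i = (\<Sum>m<9. (f j \<bullet>c f m) * (f m \<bullet>c f i))"
      using parseval_frame_polarized[OF p fc[OF j] fc[OF i]] by simp
    also have "\<dots> = (\<Sum>m<9. ((if m = j then 2 / 3 else 0) + A $$ (m, j) / 6)
       * ((if i = m then 2 / 3 else 0) + A $$ (i, m) / 6))"
      using i j by (intro sum.cong refl) (simp add: G)
    also have "\<dots> = (\<Sum>m<9. (if m = j then (if i = m then 4 / 9 else 0) + A $$ (i, m) / 9 else 0)
       + (if i = m then A $$ (m, j) / 9 else 0) + A $$ (i, m) * A $$ (m, j) / 36)"
      by (intro sum.cong refl) (simp add: algebra_simps)
    also have "\<dots> = (if i = j then 4 / 9 else 0) + A $$ (i, j) * 2 / 9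
       + (\<Sum>m<9. A $$ (i, m) * A $$ (m, j)) / 36"
      using i j by (simp add: sum.distrib sum_divide_distrib[symmetric])
    finally have "(\<Sum>m<9. A $$ (i, m) * A $$ (m, j)) =
        36 * (f j \<bullet>c f i - ((if i = j then 4 / 9 else 0) + A $$ (i, j) * 2 / 9))"
      by simp
    also have "\<dots> = (if i = j then 8 else 0) - 2 * A $$ (i, j)"
      unfolding G[OF i j] by simp
    finally have "(\<Sum>m<9. A $$ (i, m) * A $$ (m, j)) = (if i = j then 8 else 0) - 2 * A $$ (i, j)" .
    then show "(A * A) $$ (i, j) = (8 \<cdot>\<^sub>m 1\<^sub>m 9 - 2 \<cdot>\<^sub>m A) $$ (i, j)"
      using A i j by (simp add: scalar_prod_def lessThan_atLeast0)
  qed (use A in auto)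
qed

section \<open>Eigenvalues from the quadratic equation\<close>

text \<open>The equation reads \<open>(A - 2) (A + 4) = 0\<close>. It confines the eigenvalues to
  the two roots, and a non-zero column of one factor is an eigenvector for the root of the
  other.\<close>

lemma spectrum_if_square:
  fixes A :: "complex mat"
  assumes A: "A \<in> carrier_mat n n" and n: "0 < n" and A0: "A $$ (0, 0) = 0"
    and sq: "A * A = 8 \<cdot>\<^sub>m 1\<^sub>m n - 2 \<cdot>\<^sub>m A"
  shows "spectrum A = {2, - 4}"
proof
  show "spectrum A \<subseteq> {2, - 4}"
  proof
    fix e assume "e \<in> spectrum A"
    then obtain v where "eigenvector A v e"
      by (auto simp: spectrum_def eigenvalue_def)
    then have v: "v \<in> carrier_vec n" "v \<noteq> 0\<^sub>v n" "A *\<^sub>v v = e \<cdot>\<^sub>v v"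
      using A by (auto simp: eigenvector_def)
    obtain i where i: "i < n" "v $ i \<noteq> 0"
      using v by (metis carrier_vecD eq_vecI index_zero_vec(1,2))
    have smult: "(c \<cdot>\<^sub>m M) *\<^sub>v v = c \<cdot>\<^sub>v (M *\<^sub>v v)" if "M \<in> carrier_mat n n" for c M
      using that v by (intro eq_vecI) (auto simp: scalar_prod_def sum_distrib_left mult.assoc)
    have "(e * e) \<cdot>\<^sub>v v = (A * A) *\<^sub>v v"
      using A v by (simp add: assoc_mult_mat_vec[of _ n n _ n] mult_mat_vec[OF A] smult_smult_assoc)
    also have "\<dots> = 8 \<cdot>\<^sub>v v - (2 * e) \<cdot>\<^sub>v v"
      unfolding sq using A v
      by (simp add: minus_mult_distrib_mat_vec[of _ n n] smult_smult_assoc smult)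
    finally have "e * e * v $ i = 8 * v $ i - 2 * e * v $ i"
      using i v by (auto dest!: arg_cong[of _ _ "\<lambda>w. w $ i"])
    then have "(e - 2) * (e + 4) * v $ i = 0"
      by (simp add: algebra_simps)
    then show "e \<in> {2, - 4}"
      using i by (auto simp: eq_neg_iff_add_eq_0)
  qed
  \<comment> \<open>By Vieta these conditions say that \<open>e\<close> and \<open>d\<close> are the
    two roots, so both eigenvalues are treated at once.\<close>
  have ev: "e \<in> spectrum A" if e: "e + d = - 2" "d \<noteq> 0" "e * d = - 8" for e d
  proof -
    define B where "B = A - d \<cdot>\<^sub>m 1\<^sub>m n"
    have B: "B \<in> carrier_mat n n" using A by (intro carrier_matI) (simp_all add: B_def)
    have "A * (d \<cdot>\<^sub>m 1\<^sub>m n) = d \<cdot>\<^sub>m A"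
      using mult_smult_distrib[OF A one_carrier_mat, of d] A by simp
    then have "A * B = A * A - d \<cdot>\<^sub>m A"
      unfolding B_def using mult_minus_distrib_mat[OF A A, of "d \<cdot>\<^sub>m 1\<^sub>m n"] by simp
    also have "\<dots> = e \<cdot>\<^sub>m B"
    proof -
      have key: "8 * a - 2 * b - d * b = e * (b - d * a)" for a b :: complex
      proof -
        have "8 * a - 2 * b - d * b = (8 + e * d) * a - ((e + d) + 2) * b + e * (b - d * a)"
          by (simp add: algebra_simps)
        then show ?thesis using e by simp
      qed
      show ?thesis
      proof (rule eq_matI)
        fix i j assume "i < dim_row (e \<cdot>\<^sub>m B)" "j < dim_col (e \<cdot>\<^sub>m B)"
        then have "i < n" "j < n" using B by auto
        then show "(A * A - d \<cdot>\<^sub>m A) $$ (i, j) = (e \<cdot>\<^sub>m B) $$ (i, j)"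
          using key[of "if i = j then 1 else 0" "A $$ (i, j)"] A unfolding sq B_def
          by (cases "i = j") simp_all
      qed (use A B in auto)
    qed
    finally have AB: "A * B = e \<cdot>\<^sub>m B" .
    have "A *\<^sub>v col B 0 = e \<cdot>\<^sub>v col B 0"
      unfolding col_mult2[OF A B n, symmetric] AB using B n by (intro eq_vecI) auto
    \<comment> \<open>Since the corner entry of \<open>A\<close> is 0, that of \<open>B\<close> is
      \<open>- d\<close>.\<close>
    moreover have "col B 0 $ 0 \<noteq> 0" using A n A0 that by (simp add: B_def)
    ultimately have "eigenvector A (col B 0) e"
      using A B n by (auto simp: eigenvector_def simp del: index_col)
    then show ?thesis by (auto simp: spectrum_def eigenvalue_def)
  qed
  show "{2, - 4} \<subseteq> spectrum A"
    using ev[of 2 "- 4"] ev[of "- 4" 2] by simp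
qed

section \<open>Switching equivalence entry by entry\<close>

lemma switching_equivalentI:
  assumes A: "A \<in> carrier_mat n n" and B: "B \<in> carrier_mat n n"
    and d: "\<And>i. i < n \<Longrightarrow> cmod (d i) = 1" and q: "q permutes {..<n}"
    and BA: "\<And>i j. i < n \<Longrightarrow> j < n \<Longrightarrow> B $$ (i, j) = d (q i) * A $$ (q i, q j) * cnj (d (q j))"
  shows "switching_equivalent n A B"
proof -
  define D where "D = mat n n (\<lambda>(i, j). if i = j then d i else 0)"
  \<comment> \<open>\<open>permutation_mat\<close> puts the 1 of column \<open>j\<close> in row
    \<open>p j\<close>, whereas the hypothesis reads indices through \<open>q\<close>; hence
    \<open>p\<close> is the inverse of \<open>q\<close>.\<close>
  define P :: "complex mat" where "P = mat n n (\<lambda>(i, j). if i = inv_into UNIV q j then 1 else 0)"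
  have D: "D \<in> carrier_mat n n" and P: "P \<in> carrier_mat n n" by (simp_all add: D_def P_def)
  note [simp] = mat_adjoint_index
  have D': "mat_adjoint D \<in> carrier_mat n n" and P': "mat_adjoint P \<in> carrier_mat n n"
    using D P by (simp_all add: mat_adjoint_carrier)
  have dd: "d i * cnj (d i) = 1" if "i < n" for i
    using d[OF that] by (metis complex_norm_square one_power2 of_real_1)
  have D'i: "mat_adjoint D $$ (i, j) = (if i = j then cnj (d i) else 0)" if "i < n" "j < n" for i j
    using that D by (simp add: D_def)
  have Pi: "P $$ (i, j) = (if j = q i then 1 else 0)" if "i < n" "j < n" for i j
    using that permutes_inverses[OF q] by (auto simp: P_def)
  have P'i: "mat_adjoint P $$ (i, j) = (if i = q j then 1 else 0)" if "i < n" "j < n" for i j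
    using that P by (simp add: Pi)
  have qn: "q i < n" if "i < n" for i
    using permutes_in_image[OF q, of i] that by simp
  have delta: "(\<Sum>m<n. (if m = a then F m else 0)) = F a" "(\<Sum>m<n. (if a = m then F m else 0)) = F a"
    if "a < n" for a and F :: "nat \<Rightarrow> complex"
    using that by simp_all
  have prod: "(X * Y) $$ (i, j) = (\<Sum>m<n. X $$ (i, m) * Y $$ (m, j))"
    if "X \<in> carrier_mat n n" "Y \<in> carrier_mat n n" "i < n" "j < n" for X Y :: "complex mat" and i j
    using that by (simp add: scalar_prod_def lessThan_atLeast0)
  have Dl: "(D * X) $$ (i, j) = d i * X $$ (i, j)"
    if "X \<in> carrier_mat n n" "i < n" "j < n" for X i j
  proof -
    have "(D * X) $$ (i, j) = (\<Sum>m<n. if i = m then d m * X $$ (m, j) else 0)"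
      unfolding prod[OF D that] using that by (intro sum.cong) (auto simp: D_def)
    then show ?thesis using that by simp
  qed
  have Dr: "(X * mat_adjoint D) $$ (i, j) = X $$ (i, j) * cnj (d j)"
    if "X \<in> carrier_mat n n" "i < n" "j < n" for X i j
  proof -
    have "(X * mat_adjoint D) $$ (i, j) = (\<Sum>m<n. if m = j then X $$ (i, m) * cnj (d m) else 0)"
      unfolding prod[OF that(1) D' that(2,3)] using that by (intro sum.cong) (auto simp: D'i)
    then show ?thesis using that by simp
  qed
  have Pl: "(P * X) $$ (i, j) = X $$ (q i, j)"
    if "X \<in> carrier_mat n n" "i < n" "j < n" for X i j
  proof -
    have "(P * X) $$ (i, j) = (\<Sum>m<n. if m = q i then X $$ (m, j) else 0)"
      unfolding prod[OF P that] using that by (intro sum.cong) (auto simp: Pi)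
    then show ?thesis using that qn by simp
  qed
  have Pr: "(X * mat_adjoint P) $$ (i, j) = X $$ (i, q j)"
    if "X \<in> carrier_mat n n" "i < n" "j < n" for X i j
  proof -
    have "(X * mat_adjoint P) $$ (i, j) = (\<Sum>m<n. if m = q j then X $$ (i, m) else 0)"
      unfolding prod[OF that(1) P' that(2,3)] using that by (intro sum.cong) (auto simp: P'i)
    then show ?thesis using that qn by simp
  qed
  have "unitary_mat n D"
    unfolding unitary_mat_def
  proof (intro conjI D)
    show "D * mat_adjoint D = 1\<^sub>m n"
    proof (rule eq_matI)
      fix i j assume "i < dim_row (1\<^sub>m n :: complex mat)" "j < dim_col (1\<^sub>m n :: complex mat)"
      then have ij: "i < n" "j < n" by simp_all
      show "(D * mat_adjoint D) $$ (i, j) = 1\<^sub>m n $$ (i, j)"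
        unfolding Dr[OF D ij] using ij dd by (simp add: D_def)
    qed (use D D' in auto)
    show "mat_adjoint D * D = 1\<^sub>m n"
    proof (rule eq_matI)
      fix i j assume "i < dim_row (1\<^sub>m n :: complex mat)" "j < dim_col (1\<^sub>m n :: complex mat)"
      then have ij: "i < n" "j < n" by simp_all
      have "(mat_adjoint D * D) $$ (i, j) = (\<Sum>m<n. if i = m then (if m = j then cnj (d m) * d m else 0) else 0)"
        unfolding prod[OF D' D ij] using ij by (intro sum.cong) (auto simp: D'i D_def)
      then show "(mat_adjoint D * D) $$ (i, j) = 1\<^sub>m n $$ (i, j)"
        using ij dd by (simp add: mult.commute)
    qed (use D D' in auto)
  qed
  moreover have "permutation_mat n P"
    using permutes_inv[OF q] by (auto simp: permutation_mat_def P_def)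
  moreover have "diagonal_mat D"
    by (simp add: diagonal_mat_def D_def)
  moreover have "B = P * (D * A * mat_adjoint D) * mat_adjoint P"
  proof (rule eq_matI)
    fix i j
    assume "i < dim_row (P * (D * A * mat_adjoint D) * mat_adjoint P)"
      "j < dim_col (P * (D * A * mat_adjoint D) * mat_adjoint P)"
    then have ij: "i < n" "j < n" using P P' by auto
    have DA: "D * A \<in> carrier_mat n n" using D A by simp
    have M: "D * A * mat_adjoint D \<in> carrier_mat n n" using DA D' by simp
    have PM: "P * (D * A * mat_adjoint D) \<in> carrier_mat n n" using P M by simp
    show "B $$ (i, j) = (P * (D * A * mat_adjoint D) * mat_adjoint P) $$ (i, j)"
      unfolding Pr[OF PM ij] Pl[OF M ij(1) qn[OF ij(2)]] Dr[OF DA qn[OF ij(1)] qn[OF ij(2)]]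
        Dl[OF A qn[OF ij(1)] qn[OF ij(2)]]
      using BA[OF ij] .
  qed (use B P P' in auto)
  ultimately show ?thesis
    using A B by (auto simp: switching_equivalent_def)
qed

section \<open>The given matrix and its frame\<close>

lemma omega_sq: "\<omega>\<^sup>2 = - 1 - \<omega>"
  by (simp add: omega_def power2_eq_square complex_eq_iff)

text \<open>As a rewrite rule this, with its left-nested companion below, reduces polynomials in
  \<omega> to the form \<open>a + b * \<omega>\<close>, so that entries of explicit tables can be
  compared.\<close>

lemma omega_times_omega: "\<omega> * \<omega> = - 1 - \<omega>"
  using omega_sq by (simp add: power2_eq_square)

lemma omega_times_omega_left: "\<omega> * (\<omega> * z) = - z - \<omega> * z"
  by (simp add: omega_times_omega algebra_simps flip: mult.assoc)

lemma cnj_omega: "cnj \<omega> = - 1 - \<omega>"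
  by (simp add: omega_def complex_eq_iff)

lemma cmod_omega: "cmod \<omega> = 1"
  by (simp add: omega_def cmod_def power_divide)

lemma omega_cube: "\<omega> ^ 3 = 1"
  by (simp add: power3_eq_cube omega_times_omega algebra_simps)

lemma cube_root_of_unity_iff: "z ^ 3 = 1 \<longleftrightarrow> z \<in> {1, \<omega>, \<omega>\<^sup>2}"
proof -
  have "z ^ 3 - 1 = (z - 1) * (z - \<omega>) * (z - \<omega>\<^sup>2)"
    by (simp add: power3_eq_cube omega_sq omega_times_omega omega_times_omega_left algebra_simps)
  then show ?thesis by (metis eq_iff_diff_eq_0 insert_iff mult_eq_0_iff singleton_iff)
qed

lemma omega_neq: "\<omega> \<noteq> 1" "\<omega>\<^sup>2 \<noteq> 1" "\<omega> \<noteq> \<omega>\<^sup>2" "\<omega> \<noteq> 0"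
  unfolding omega_sq by (simp_all add: omega_def complex_eq_iff)

section \<open>Seidel properties of the given matrix\<close>

lemma Q9_carrier: "Q9 \<in> carrier_mat 9 9"
  by (rule carrier_matI) (simp_all add: Q9_def mat_of_rows_list_def)

lemma Q9_entry:
  "i < 9 \<Longrightarrow> j < 9 \<Longrightarrow> i \<noteq> j \<Longrightarrow> Q9 $$ (i, j) \<in> {1, \<omega>, \<omega>\<^sup>2}"
  by (simp add: Q9_def mat_of_rows_list_def numeral_eq_Suc less_Suc_eq) (elim disjE; simp)

lemma Q9_diag: "i < 9 \<Longrightarrow> Q9 $$ (i, i) = 0"
  by (simp add: Q9_def mat_of_rows_list_def numeral_eq_Suc less_Suc_eq) (elim disjE; simp)

lemma Q9_hermitian: "i < 9 \<Longrightarrow> j < 9 \<Longrightarrow> cnj (Q9 $$ (j, i)) = Q9 $$ (i, j)"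
  by (simp add: Q9_def mat_of_rows_list_def numeral_eq_Suc less_Suc_eq)
    (elim disjE; simp add: cnj_omega omega_times_omega algebra_simps)

lemma cube_root_seidel_Q9: "cube_root_seidel_matrix 9 Q9"
proof -
  have "(Q9 $$ (i, j)) ^ 3 = 1" if "i < 9" "j < 9" "i \<noteq> j" for i j
    using Q9_entry[OF that] by (simp add: cube_root_of_unity_iff)
  moreover have "cmod (Q9 $$ (i, j)) = 1" if "i < 9" "j < 9" "i \<noteq> j" for i j
    using Q9_entry[OF that] by (auto simp: cmod_omega norm_power)
  moreover have "mat_adjoint Q9 = Q9"
    using Q9_carrier mat_adjoint_carrier[OF Q9_carrier]
    by (intro eq_matI) (auto simp: mat_adjoint_index Q9_hermitian)
  ultimately show ?thesis
    using Q9_carrier Q9_diag by (simp add: cube_root_seidel_matrix_def seidel_matrix_def)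
qed

section \<open>An explicit frame\<close>

text \<open>The weights normalise the columns of the coefficient table below: the first three have
  three entries of modulus 1, the last three have six.\<close>

definition Q9_frame_weight :: "nat \<Rightarrow> complex" where
  "Q9_frame_weight c = complex_of_real (if c < 3 then sqrt (1 / 3) else sqrt (1 / 6))"

text \<open>The three parallel lines \<open>{0, 1, 2}\<close>, \<open>{3, 4, 5}\<close>, \<open>{6, 7, 8}\<close> cut \<^term>\<open>Q9\<close> into
  \<open>3 \<times> 3\<close> blocks. The coordinates 0, 1, 2 of the frame are supported on one line each, the
  coordinates 3, 4, 5 on two lines each, and the restrictions to a line are multiples of
  characters of the cyclic group of order 3.\<close>

definition Q9_frame_coeffs :: "complex list list" where
  "Q9_frame_coeffs =
    [[1, 0,   0,   1,   1,   0],
     [1, 0,   0,   \<omega>^2, \<omega>,   0],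
     [1, 0,   0,   \<omega>,   \<omega>^2, 0],
     [0, 1,   0,   1,   0,   1],
     [0, \<omega>,   0,   1,   0,   \<omega>^2],
     [0, \<omega>^2, 0,   1,   0,   \<omega>],
     [0, 0,   1,   0,   1,   1],
     [0, 0,   \<omega>^2, 0,   1,   \<omega>],
     [0, 0,   \<omega>,   0,   1,   \<omega>^2]]"

definition Q9_frame :: "nat \<Rightarrow> complex vec" where
  "Q9_frame i = vec 6 (\<lambda>c. Q9_frame_weight c * Q9_frame_coeffs ! i ! c)"

lemma Q9_frame_weight_sq:
  "cnj (Q9_frame_weight c) = Q9_frame_weight c"
  "Q9_frame_weight c * Q9_frame_weight c = (if c < 3 then 1 / 3 else 1 / 6)"
  by (simp_all add: Q9_frame_weight_def flip: of_real_mult)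

lemma Q9_frame_parseval: "parseval_frame 9 6 Q9_frame"
proof (rule parseval_frameI)
  fix c d :: nat assume cd: "c < 6" "d < 6"
  \<comment> \<open>Columns that meet in a line restrict there to different characters of the cyclic
    group, so they are orthogonal on each line.\<close>
  have S: "(\<Sum>j<9. cnj (Q9_frame_coeffs ! j ! c) * Q9_frame_coeffs ! j ! d) =
    (if c = d then if c < 3 then 3 else 6 else 0)"
    using cd
    by (simp add: Q9_frame_coeffs_def numeral_eq_Suc less_Suc_eq)
      (elim disjE; simp add: cnj_omega omega_times_omega algebra_simps)
  have "(\<Sum>j<9. cnj (Q9_frame j $ c) * Q9_frame j $ d) =
      Q9_frame_weight c * Q9_frame_weight d *
      (\<Sum>j<9. cnj (Q9_frame_coeffs ! j ! c) * Q9_frame_coeffs ! j ! d)"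
    using cd by (simp add: Q9_frame_def Q9_frame_weight_sq(1) sum_distrib_left mult_ac)
  then show "(\<Sum>j<9. cnj (Q9_frame j $ c) * Q9_frame j $ d) = (if c = d then 1 else 0)"
    unfolding S using Q9_frame_weight_sq(2)[of c] by auto
qed (simp add: Q9_frame_def)

lemma Q9_frame_gram:
  assumes "i < 9" "j < 9"
  shows "Q9_frame j \<bullet>c Q9_frame i = (if i = j then 2 / 3 else 0) + Q9 $$ (i, j) / 6"
proof -
  have "Q9_frame j \<bullet>c Q9_frame i =
    (\<Sum>c<6. (Q9_frame_weight c * Q9_frame_weight c) *
        (Q9_frame_coeffs ! j ! c * cnj (Q9_frame_coeffs ! i ! c)))"
    by (subst cscalar_prod_sum[of _ 6])
      (auto simp: Q9_frame_def Q9_frame_weight_sq(1) mult_ac intro!: sum.cong)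
  also have "\<dots> = (\<Sum>c<6. (if c < 3 then 1 / 3 else 1 / 6) *
        (Q9_frame_coeffs ! j ! c * cnj (Q9_frame_coeffs ! i ! c)))"
    by (simp only: Q9_frame_weight_sq(2))
  also have "\<dots> = (if i = j then 2 / 3 else 0) + Q9 $$ (i, j) / 6"
    using assms
    by (simp add: Q9_frame_coeffs_def Q9_def mat_of_rows_list_def numeral_eq_Suc less_Suc_eq)
      (elim disjE; simp add: cnj_omega omega_times_omega field_simps)
  finally show ?thesis .
qed

lemma cmod_cscalar_prod_normalize:
  assumes "x \<in> carrier_vec k" "y \<in> carrier_vec k"
  shows "cmod (cvec_normalize x \<bullet>c cvec_normalize y) = cmod (x \<bullet>c y) / (cvec_norm x * cvec_norm y)"
proof -
  have "cvec_normalize x \<bullet>c cvec_normalize y =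
    complex_of_real (1 / cvec_norm x) * complex_of_real (1 / cvec_norm y) * (x \<bullet>c y)"
    using assms by (simp add: cvec_normalize_def cscalar_prod_sum[of _ k] sum_distrib_left mult_ac sum_divide_distrib)
  moreover have "cvec_norm u \<ge> 0" for u
    by (simp add: cvec_norm_def L2_set_nonneg)
  ultimately show ?thesis
    by (simp add: norm_mult norm_divide abs_of_nonneg)
qed

lemma Q9_frame_equiangular: "equiangular_frame 9 6 Q9_frame"
proof -
  have fc: "Q9_frame i \<in> carrier_vec 6" for i
    by (simp add: Q9_frame_def)
  have "Q9_frame i \<noteq> 0\<^sub>v 6" if "i < 9" for i
    using Q9_frame_gram[OF that that] Q9_diag[OF that] by auto
  moreover have "cvec_norm (Q9_frame i) = sqrt (2 / 3)" if "i < 9" for i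
  proof -
    have "complex_of_real ((cvec_norm (Q9_frame i))\<^sup>2) = complex_of_real (2 / 3)"
      unfolding cvec_norm_sq Q9_frame_gram[OF that that] by (simp add: Q9_diag[OF that])
    then have "(cvec_norm (Q9_frame i))\<^sup>2 = 2 / 3"
      by (simp only: of_real_eq_iff)
    then show ?thesis
      by (metis L2_set_nonneg cvec_norm_def real_sqrt_unique)
  qed
  \<comment> \<open>Off-diagonal Gram entries have modulus 1 / 6 and the squared norms are 2 / 3,
    which gives the common value (1 / 6) / (2 / 3).\<close>
  then have "cmod (cvec_normalize (Q9_frame i) \<bullet>c cvec_normalize (Q9_frame j)) = 1 / 4"
    if "i < 9" "j < 9" "i \<noteq> j" for i j
    using that cube_root_seidel_Q9
    by (simp add: cmod_cscalar_prod_normalize[OF fc fc] Q9_frame_gram norm_divide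
        cube_root_seidel_matrix_def seidel_matrix_def)
  ultimately show ?thesis
    using Q9_frame_parseval unfolding equiangular_frame_def by blast
qed

lemma Q9_signature_matrix: "signature_matrix_of_frame 9 6 Q9"
proof -
  have c: "signature_const 9 6 = 1 / 6"
    by (simp add: signature_const_def real_sqrt_divide)
  have "mat 9 9 (\<lambda>(i, j). Q9_frame j \<bullet>c Q9_frame i) =
      complex_of_real (real 6 / real 9) \<cdot>\<^sub>m 1\<^sub>m 9 + complex_of_real (signature_const 9 6) \<cdot>\<^sub>m Q9"
    unfolding c using Q9_carrier by (intro eq_matI) (auto simp: Q9_frame_gram)
  then show ?thesis
    using cube_root_seidel_Q9 Q9_frame_equiangular
    unfolding signature_matrix_of_frame_def cube_root_seidel_matrix_def by blast
qed

text \<open>The matrix is already in standard form and serves as its own witness, with an entry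
  \<omega>.\<close>

lemma Q9_nontrivial: "nontrivial_seidel 9 Q9"
proof -
  have "standard_form 9 Q9"
    using cube_root_seidel_Q9 unfolding standard_form_def cube_root_seidel_matrix_def
    by (auto simp: Q9_def mat_of_rows_list_def numeral_eq_Suc less_Suc_eq)
  moreover have "switching_equivalent 9 Q9 Q9"
    by (rule switching_equivalentI[where d = "\<lambda>_. 1" and q = id])
      (simp_all add: Q9_carrier permutes_id)
  moreover have "Q9 $$ (1, 3) \<noteq> 1"
    by (simp add: Q9_def mat_of_rows_list_def omega_neq)
  ultimately show ?thesis
    unfolding nontrivial_seidel_def standard_form_of_def
    by (intro exI[of _ Q9] conjI exI[of _ 1] exI[of _ 3]) auto
qed

lemma Q9_nontrivial_cube_root_signature_matrix:
  "nontrivial_cube_root_signature_matrix_of_frame 9 6 Q9"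
  using spectrum_if_square[OF Q9_carrier _ Q9_diag signature_matrix_square[OF Q9_signature_matrix]]
  by (simp add: nontrivial_cube_root_signature_matrix_of_frame_def cube_root_signature_matrix_def
      cube_root_seidel_Q9 Q9_nontrivial Q9_signature_matrix)

section \<open>Uniqueness\<close>

text \<open>The real part, the imaginary part and the total 7 give three linear equations for the
  multiplicities of the three roots. Their only solution is 1, 3, 3.\<close>

lemma cube_roots_sum_minus_two:
  fixes x :: "'a \<Rightarrow> complex"
  assumes fin: "finite K" and card: "card K = 7"
    and root: "\<And>k. k \<in> K \<Longrightarrow> x k \<in> {1, \<omega>, \<omega>\<^sup>2}" and sum: "sum x K = - 2"
  shows "card {k \<in> K. x k = 1} = 1" "card {k \<in> K. x k = \<omega>} = 3"
proof -
  define c where "c z = card {k \<in> K. x k = z}" for z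
  have ind: "(\<Sum>k\<in>K. if x k = z then a else 0) = of_nat (c z) * a"
    for z a :: complex
    using fin by (simp add: c_def sum.If_cases Int_def)
  have "- 2 = (\<Sum>k\<in>K. (if x k = 1 then 1 else 0) + (if x k = \<omega> then \<omega> else 0)
      + (if x k = \<omega>\<^sup>2 then \<omega>\<^sup>2 else 0))"
    unfolding sum[symmetric] using root omega_neq by (intro sum.cong) auto
  also have "\<dots> = of_nat (c 1) + of_nat (c \<omega>) * \<omega> + of_nat (c (\<omega>\<^sup>2)) * \<omega>\<^sup>2"
    by (simp add: sum.distrib ind)
  finally have "of_nat (c 1) + of_nat (c \<omega>) * \<omega> + of_nat (c (\<omega>\<^sup>2)) * (- 1 - \<omega>) = - 2"
    by (simp add: omega_sq)
  then have "real (c 1) - real (c \<omega>) / 2 - real (c (\<omega>\<^sup>2)) / 2 = - 2" "real (c \<omega>) = real (c (\<omega>\<^sup>2))"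
    by (simp_all add: complex_eq_iff omega_def field_simps)
  moreover have "c 1 + c \<omega> + c (\<omega>\<^sup>2) = 7"
  proof -
    have "of_nat (c 1 + c \<omega> + c (\<omega>\<^sup>2)) = (\<Sum>k\<in>K. (if x k = 1 then 1 else 0)
       + (if x k = \<omega> then 1 else 0) + (if x k = \<omega>\<^sup>2 then 1 else 0 :: complex))"
      by (simp add: sum.distrib ind)
    also have "\<dots> = (\<Sum>k\<in>K. 1)"
      using root omega_neq by (intro sum.cong) auto
    finally show ?thesis using card by (metis of_nat_eq_iff of_nat_sum sum_constant mult.right_neutral)
  qed
  ultimately have "c 1 = 1" "c \<omega> = 3" by linarith+
  then show "card {k \<in> K. x k = 1} = 1" "card {k \<in> K. x k = \<omega>} = 3"
    by (simp_all add: c_def)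
qed

text \<open>Turns an enumeration of the indices into the permutation that switching requires;
  \<open>permutes\<close> demands the identity outside the index set.\<close>

lemma nth_permutes:
  assumes "distinct l" "set l = {..<length l}"
  shows "(\<lambda>i. if i < length l then l ! i else i) permutes {..<length l}"
proof (rule bij_imp_permutes)
  have "bij_betw (\<lambda>i. l ! i) {..<length l} {..<length l}"
    using bij_betw_nth[OF assms(1) refl assms(2)[symmetric]] .
  then show "bij_betw (\<lambda>i. if i < length l then l ! i else i) {..<length l} {..<length l}"
    by (rule bij_betw_cong[THEN iffD1, rotated]) simp
qed simp

section \<open>Combinatorics of a normalised signature matrix\<close>

text \<open>\<open>square\<close> is the off-diagonal part of the quadratic equation. The diagonal
  part is automatic, since each row has eight entries of modulus 1.\<close>

locale standard_cube_root_signature =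
  fixes b :: "nat \<Rightarrow> nat \<Rightarrow> complex"
  assumes diag: "i < 9 \<Longrightarrow> b i i = 0"
    and entry: "i < 9 \<Longrightarrow> j < 9 \<Longrightarrow> i \<noteq> j \<Longrightarrow> b i j \<in> {1, \<omega>, \<omega>\<^sup>2}"
    and hermitian: "i < 9 \<Longrightarrow> j < 9 \<Longrightarrow> cnj (b i j) = b j i"
    and first_row: "i < 9 \<Longrightarrow> i \<noteq> 0 \<Longrightarrow> b 0 i = 1"
    and square: "i < 9 \<Longrightarrow> j < 9 \<Longrightarrow> i \<noteq> j \<Longrightarrow> (\<Sum>k<9. b i k * b k j) = - 2 * b i j"
begin

lemma first_col: "i < 9 \<Longrightarrow> i \<noteq> 0 \<Longrightarrow> b i 0 = 1"
  using hermitian[of 0 i] first_row by simp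

lemma transpose_entry:
  assumes "i < 9" "j < 9" "i \<noteq> j"
  shows "b j i = 1 \<longleftrightarrow> b i j = 1" "b j i = \<omega> \<longleftrightarrow> b i j = \<omega>\<^sup>2" "b j i = \<omega>\<^sup>2 \<longleftrightarrow> b i j = \<omega>"
    and "b i j * b j i = 1"
proof -
  have w: "cnj \<omega> = \<omega>\<^sup>2" "cnj (\<omega>\<^sup>2) = \<omega>" "\<omega> * \<omega>\<^sup>2 = 1" "\<omega>\<^sup>2 * \<omega> = 1"
    using omega_cube by (simp_all add: omega_sq cnj_omega omega_times_omega algebra_simps)
  show "b j i = 1 \<longleftrightarrow> b i j = 1" "b j i = \<omega> \<longleftrightarrow> b i j = \<omega>\<^sup>2" "b j i = \<omega>\<^sup>2 \<longleftrightarrow> b i j = \<omega>"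
    "b i j * b j i = 1"
    using entry[OF assms] hermitian[OF assms(1,2)] w omega_neq omega_neq[symmetric] by auto
qed

text \<open>Multiplying \<open>square\<close> by \<open>b j i\<close> turns its right side into -2.
  The terms at \<open>i\<close> and \<open>j\<close> vanish because the diagonal is zero, which
  leaves seven cube roots of unity to count.\<close>

lemma products:
  assumes "i < 9" "j < 9" "i \<noteq> j"
  defines "K \<equiv> {..<9} - {i, j}" and "x \<equiv> \<lambda>k. b i k * b k j * b j i"
  shows "card {k \<in> K. x k = 1} = 1" "card {k \<in> K. x k = \<omega>} = 3"
proof -
  have root: "x k \<in> {1, \<omega>, \<omega>\<^sup>2}" if "k \<in> K" for k
  proof -
    have "b i k ^ 3 = 1" "b k j ^ 3 = 1" "b j i ^ 3 = 1"
      using that assms entry[of i k] entry[of k j] entry[of j i]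
      by (auto simp only: cube_root_of_unity_iff K_def)
    then show ?thesis
      by (simp only: cube_root_of_unity_iff[symmetric] x_def power_mult_distrib mult_1)
  qed
  have "sum x K = (\<Sum>k<9. x k)"
    using assms diag by (intro sum.mono_neutral_left) (auto simp: K_def x_def)
  also have "\<dots> = - 2 * (b i j * b j i)"
    using square[OF assms(1-3)] by (simp add: x_def flip: sum_distrib_right)
  finally have sum: "sum x K = - 2" using transpose_entry[OF assms(1-3)] by simp
  have "finite K" "card K = 7" using assms by (auto simp: K_def card_Diff_subset)
  then show "card {k \<in> K. x k = 1} = 1" "card {k \<in> K. x k = \<omega>} = 3"
    using cube_roots_sum_minus_two[OF _ _ root sum] by blast+
qed

text \<open>The triples with product 1 form a Steiner triple system: the lines of the affine plane
  of order 3.\<close>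

lemma unique_third:
  assumes "i < 9" "j < 9" "i \<noteq> j"
  shows "\<exists>!k. k < 9 \<and> k \<noteq> i \<and> k \<noteq> j \<and> b i k * b k j = b i j"
proof -
  have "b i k * b k j * b j i = 1 \<longleftrightarrow> b i k * b k j = b i j" for k
    using transpose_entry(4)[OF assms] by (metis mult.assoc mult.commute mult_1)
  then have "card {k. k < 9 \<and> k \<noteq> i \<and> k \<noteq> j \<and> b i k * b k j = b i j} = 1"
    using products(1)[OF assms] by (simp add: conj_ac)
  then obtain k where "{k. k < 9 \<and> k \<noteq> i \<and> k \<noteq> j \<and> b i k * b k j = b i j} = {k}"
    by (rule card_1_singletonE)
  then show ?thesis
    unfolding set_eq_iff mem_Collect_eq singleton_iff by (intro ex1I[of _ k]) blast+
qed

section \<open>Partners with respect to the index 0\<close>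

text \<open>This is the third point of the line through 0 and \<open>i\<close>: row and column 0
  consist of 1s, so the triple 0, \<open>k\<close>, \<open>i\<close> has product 1 exactly when
  \<open>b i k = 1\<close>. The value is meaningful only for \<open>0 < i < 9\<close>.\<close>

definition partner :: "nat \<Rightarrow> nat" where
  "partner i = (THE k. k < 9 \<and> k \<noteq> 0 \<and> k \<noteq> i \<and> b i k = 1)"

lemma partner_unique:
  assumes "i < 9" "i \<noteq> 0"
  shows "\<exists>!k. k < 9 \<and> k \<noteq> 0 \<and> k \<noteq> i \<and> b i k = 1"
proof -
  have "(k < 9 \<and> k \<noteq> 0 \<and> k \<noteq> i \<and> b i k = 1) \<longleftrightarrow>
    (k < 9 \<and> k \<noteq> 0 \<and> k \<noteq> i \<and> b 0 k * b k i = b 0 i)" for k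
    using assms first_row transpose_entry(1)[of k i] by auto
  then show ?thesis
    using unique_third[of 0 i] assms by auto
qed

lemma partner:
  assumes "i < 9" "i \<noteq> 0"
  shows "partner i < 9" "partner i \<noteq> 0" "partner i \<noteq> i" "b i (partner i) = 1"
  using theI'[OF partner_unique[OF assms]] by (simp_all add: partner_def)

lemma partner_eqI:
  assumes "i < 9" "i \<noteq> 0" "k < 9" "k \<noteq> 0" "k \<noteq> i" "b i k = 1"
  shows "partner i = k"
  using partner_unique[OF assms(1,2)] partner[OF assms(1,2)] assms by blast

lemma partner_partner:
  assumes "i < 9" "i \<noteq> 0"
  shows "partner (partner i) = i"
  using partner[OF assms] assms transpose_entry(1)[of i "partner i"]
  by (intro partner_eqI) auto

text \<open>Since 0 is the third point of the line through \<open>i\<close> and its partner, the triple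
  \<open>i\<close>, \<open>partner i\<close>, \<open>k\<close> has a product other than 1; so passing to the partner inverts.\<close>

lemma partner_entry:
  assumes i: "i < 9" "i \<noteq> 0" and k: "k < 9" "k \<noteq> 0" "k \<noteq> i" "k \<noteq> partner i"
  shows "b i k = \<omega> \<and> b (partner i) k = \<omega>\<^sup>2 \<or> b i k = \<omega>\<^sup>2 \<and> b (partner i) k = \<omega>"
proof -
  note p = partner[OF i]
  have "b i k \<noteq> 1" using partner_eqI[OF i k(1-3)] k(4) by auto
  moreover have "b (partner i) k \<noteq> 1"
    using partner_eqI[OF p(1,2) k(1,2)] k partner_partner[OF i] by auto
  moreover have "b i k \<noteq> b (partner i) k"
  proof
    assume "b i k = b (partner i) k"
    then have "b i k * b k (partner i) = b i (partner i)"
      using transpose_entry(4)[of "partner i" k] p k by auto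
    moreover have "b i 0 * b 0 (partner i) = b i (partner i)"
      using i p first_row first_col by simp
    ultimately show False
      using unique_third[of i "partner i"] i p k by (metis zero_less_numeral)
  qed
  ultimately show ?thesis
    using entry[of i k] entry[of "partner i" k] i p k by auto
qed

text \<open>Inverting an entry is the same as transposing it, so one passage to a partner transposes
  and two passages cancel.\<close>

lemma partner_rules:
  assumes "i < 9" "i \<noteq> 0" "k < 9" "k \<noteq> 0" "k \<noteq> i" "k \<noteq> partner i"
  shows "b (partner i) k = b k i" "b k (partner i) = b i k"
    "b (partner i) (partner k) = b i k"
proof -
  have kp: "partner k < 9" "partner k \<noteq> 0" "partner k \<noteq> i" "partner k \<noteq> partner i"
    using partner[OF assms(1,2)] partner[OF assms(3,4)] partner_partner[OF assms(1,2)]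
      partner_partner[OF assms(3,4)] assms by metis+
  have gen: "b (partner i) k = b k i \<and> b k (partner i) = b i k"
    if "i < 9" "i \<noteq> 0" "k < 9" "k \<noteq> 0" "k \<noteq> i" "k \<noteq> partner i" for i k
    using partner_entry[OF that] transpose_entry[of i k] transpose_entry[of "partner i" k]
      partner[OF that(1,2)] that by auto
  show "b (partner i) k = b k i" "b k (partner i) = b i k" using gen[OF assms] by auto
  \<comment> \<open>The first passage, at \<open>i\<close>, gives \<open>b (partner k) i\<close>;
    the second, at \<open>k\<close>, gives \<open>b i k\<close>.\<close>
  have "i \<noteq> partner k" using kp by auto
  then show "b (partner i) (partner k) = b i k"
    using gen[OF assms(1,2) kp] gen[OF assms(3,4,1,2)] assms by auto
qed

text \<open>The pair \<open>a\<close>, \<open>x\<close> has its unique third point among \<open>partner y\<close> and \<open>partner z\<close>.\<close>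

lemma out_neighbours:
  assumes a: "a < 9" "a \<noteq> 0"
    and lt: "x < 9" "y < 9" "z < 9" and d: "x \<noteq> y" "x \<noteq> z" "y \<noteq> z"
    and out: "{k. k < 9 \<and> b a k = \<omega>} = {x, y, z}"
  shows "distinct [0, a, partner a, x, y, z, partner x, partner z, partner y]"
    and "b x y = \<omega>\<^sup>2 \<longleftrightarrow> b x z \<noteq> \<omega>\<^sup>2"
proof -
  have ax: "b a x = \<omega>" "b a y = \<omega>" "b a z = \<omega>"
    using out by (auto simp: set_eq_iff)
  \<comment> \<open>These facts hold for any \<open>k\<close> with \<open>b a k = \<omega>\<close>
    and are then used at \<open>x\<close>, \<open>y\<close> and \<open>z\<close>.\<close>
  have ne: "k \<noteq> 0" "k \<noteq> a" "k \<noteq> partner a" "partner k \<noteq> 0" "partner k \<noteq> a"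
      "partner k \<noteq> partner a" "partner k < 9" "b a (partner k) = \<omega>\<^sup>2" "b (partner a) k = \<omega>\<^sup>2"
    if k: "k < 9" "b a k = \<omega>" for k
  proof -
    have "b a 0 \<noteq> \<omega>" "b a a \<noteq> \<omega>" "b a (partner a) \<noteq> \<omega>"
      using a diag[of a] first_col[of a] partner[of a] omega_neq by auto
    then have 1: "k \<noteq> 0" "k \<noteq> a" "k \<noteq> partner a"
      using k by metis+
    then have 2: "a \<noteq> partner k"
      using partner_partner[of k] k by auto
    have ka: "b k a = \<omega>\<^sup>2"
      using transpose_entry(3)[OF a(1) k(1)] 1(2) k(2) by simp
    show "k \<noteq> 0" "k \<noteq> a" "k \<noteq> partner a" "partner k \<noteq> 0" "partner k \<noteq> a" "partner k < 9"
      using 1 2 partner[OF k(1)] by simp_all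
    show "partner k \<noteq> partner a"
      using 1 k(1) a partner_partner by metis
    show "b a (partner k) = \<omega>\<^sup>2"
      using partner_rules(2)[OF k(1) 1(1) a 1(2)[symmetric] 2] ka by simp
    show "b (partner a) k = \<omega>\<^sup>2"
      using partner_rules(1)[OF a k(1) 1] ka by simp
  qed
  note nx = ne[OF lt(1) ax(1)] and ny = ne[OF lt(2) ax(2)] and nz = ne[OF lt(3) ax(3)]
  have pp: "partner x \<noteq> partner y" "partner x \<noteq> partner z" "partner y \<noteq> partner z"
    using partner_partner lt nx ny nz d by metis+
  have px: "partner u \<noteq> v" if "u \<in> {x, y, z}" "v \<in> {x, y, z}" for u v
    using that ax nx ny nz omega_neq by auto
  have pn: "partner x \<noteq> x" "partner x \<noteq> y" "partner x \<noteq> z" "partner y \<noteq> x" "partner y \<noteq> y"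
    "partner y \<noteq> z" "partner z \<noteq> x" "partner z \<noteq> y" "partner z \<noteq> z"
    by (simp_all add: px)
  note neqs = a(2) partner(2,3)[OF a] nx(1-6) ny(1-6) nz(1-6) pp pn d
  show dist: "distinct [0, a, partner a, x, y, z, partner x, partner z, partner y]"
    by (simp only: distinct.simps list.set insert_iff empty_iff de_Morgan_disj simp_thms)
      (intro conjI; rule neqs neqs[symmetric])
  \<comment> \<open>Nine distinct indices below 9 exhaust the index set, so the search for the third
    point becomes a finite case distinction.\<close>
  then have "set [0, a, partner a, x, y, z, partner x, partner z, partner y] = {..<9}"
    using a partner[OF a] lt nx ny nz by (intro card_subset_eq) (auto simp: distinct_card)
  then have cases: "k \<in> {0, a, partner a, x, y, z, partner x, partner z, partner y}" if "k < 9" for k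
    using that by (metis lessThan_iff list.simps(15) empty_set)
  have w: "\<omega> * \<omega>\<^sup>2 = 1" "\<omega>\<^sup>2 * \<omega> = 1" "\<omega>\<^sup>2 * \<omega>\<^sup>2 = \<omega>"
    by (simp_all add: omega_sq omega_times_omega omega_times_omega_left algebra_simps)
  have ne1: "b y x \<noteq> 1" "b z x \<noteq> 1"
    using partner_eqI[OF lt(2) ny(1) lt(1) nx(1) d(1)] partner_eqI[OF lt(3) nz(1) lt(1) nx(1) d(2)]
      pn(4,7) by metis+
  then have vals: "b x y \<in> {\<omega>, \<omega>\<^sup>2}" "b x z \<in> {\<omega>, \<omega>\<^sup>2}"
    using entry[of x y] entry[of x z] transpose_entry(1)[of x y] transpose_entry(1)[of x z] d lt
    by blast+
  have opp: "b (partner y) x = b x y" "b (partner z) x = b x z"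
    using partner_rules(1)[OF lt(2) ny(1) lt(1) nx(1) d(1) pn(4)[symmetric]]
      partner_rules(1)[OF lt(3) nz(1) lt(1) nx(1) d(2) pn(7)[symmetric]] by simp_all
  \<comment> \<open>A third point \<open>m\<close> of the line through \<open>a\<close> and
    \<open>x\<close> needs \<open>b a m * b m x = b a x = \<omega>\<close>. The index 0 gives 1,
    both \<open>partner a\<close> and \<open>partner x\<close> give \<open>\<omega>\<^sup>2\<close>,
    and \<open>y\<close>, \<open>z\<close> would need an entry 1 with \<open>x\<close>.\<close>
  have not_third: "b a 0 * b 0 x \<noteq> \<omega>" "b a (partner a) * b (partner a) x \<noteq> \<omega>"
    "b a y * b y x \<noteq> \<omega>" "b a z * b z x \<noteq> \<omega>" "b a (partner x) * b (partner x) x \<noteq> \<omega>"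
    using first_row[OF lt(1) nx(1)] first_col[OF a] partner(4)[OF a] ne1 ax nx(8,9)
      transpose_entry(1)[OF lt(1) nx(7) pn(1)[symmetric]] partner(4)[OF lt(1) nx(1)]
      omega_neq omega_neq[symmetric]
    by simp_all
  have third: "b a (partner y) * b (partner y) x = \<omega> \<longleftrightarrow> b x y = \<omega>\<^sup>2"
    "b a (partner z) * b (partner z) x = \<omega> \<longleftrightarrow> b x z = \<omega>\<^sup>2"
    unfolding opp ny(8) nz(8) using vals w omega_neq by auto
  obtain k where k: "k < 9" "k \<noteq> a" "k \<noteq> x" "b a k * b k x = \<omega>"
    and uniq: "\<And>m. m < 9 \<Longrightarrow> m \<noteq> a \<Longrightarrow> m \<noteq> x \<Longrightarrow> b a m * b m x = \<omega> \<Longrightarrow> m = k"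
    using unique_third[OF a(1) lt(1) nx(2)[symmetric]] unfolding ax(1) by metis
  have "k = partner y \<or> k = partner z"
    using cases[OF k(1)] k not_third by blast
  \<comment> \<open>One of the two remaining candidates is the third point, and uniqueness excludes
    both being so.\<close>
  then show "b x y = \<omega>\<^sup>2 \<longleftrightarrow> b x z \<noteq> \<omega>\<^sup>2"
    using k(4) third uniq[OF ny(7,5) pn(4)] uniq[OF nz(7,5) pn(7)] pp(3) by metis
qed

section \<open>Recovering the given matrix\<close>

text \<open>The choice \<open>b x y = \<omega>\<close> orients the tournament as \<open>x\<close>,
  \<open>y\<close>, \<open>z\<close>, back to \<open>x\<close>, and the partner rules then fix all
  other entries. In the given matrix the rows 3, 4, 5 have partners 6, 8, 7, which is why
  \<open>partner z\<close> precedes \<open>partner y\<close>.\<close>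

lemma cyclic_triple_enumeration:
  assumes a: "a < 9" "a \<noteq> 0"
    and lt: "x < 9" "y < 9" "z < 9" and d: "x \<noteq> y" "x \<noteq> z" "y \<noteq> z"
    and out: "{k. k < 9 \<and> b a k = \<omega>} = {x, y, z}"
    and xy: "b x y = \<omega>"
  defines "l \<equiv> [0, a, partner a, x, y, z, partner x, partner z, partner y]"
  shows "distinct l" "set l = {..<9}"
    "\<And>i j. i < 9 \<Longrightarrow> j < 9 \<Longrightarrow> Q9 $$ (i, j) = b (l ! i) (l ! j)"
proof -
  let ?l = "[0, a, partner a, x, y, z, partner x, partner z, partner y]"
  have dist: "distinct ?l"
    using out_neighbours(1)[OF a lt d out] .
  then show "distinct l" by (simp only: l_def)
  have nz: "x \<noteq> 0" "y \<noteq> 0" "z \<noteq> 0" using dist by auto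
  have sub: "set l \<subseteq> {..<9}"
    using a lt nz partner(1) by (simp add: l_def)
  then show set: "set l = {..<9}"
    using distinct_card[OF dist] by (intro card_subset_eq) (auto simp: l_def)
  \<comment> \<open>An entry 1 would make \<open>u\<close> and \<open>v\<close> partners, against
    the distinctness of the list.\<close>
  have neg: "b u v \<noteq> 1" if "u \<in> {x, y, z}" "v \<in> {x, y, z}" "u \<noteq> v" for u v
    using that partner_eqI[of u v] dist lt nz by auto
  have xz: "b x z = \<omega>\<^sup>2"
    using out_neighbours(2)[OF a lt d out] xy omega_neq by auto
  have "b y x = \<omega>\<^sup>2"
    using transpose_entry(3)[of x y] xy lt d by simp
  \<comment> \<open>The same dichotomy is applied with \<open>y\<close> in the role of
    \<open>x\<close>.\<close>
  then have "b y z \<noteq> \<omega>\<^sup>2"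
    using out_neighbours(2)[OF a lt(2,1,3), unfolded out] d by (simp add: insert_commute)
  then have yz: "b y z = \<omega>"
    using entry[of y z] neg[of y z] lt d by auto
  have ax: "b a x = \<omega>" "b a y = \<omega>" "b a z = \<omega>"
    using out by (auto simp: set_eq_iff)
  have inner: "b a (partner a) = 1" "b x (partner x) = 1" "b y (partner y) = 1" "b z (partner z) = 1"
    using partner(4) a lt nz by auto
  have xa: "b x a = \<omega>\<^sup>2" "b y a = \<omega>\<^sup>2" "b z a = \<omega>\<^sup>2"
    using transpose_entry(3)[of a x] transpose_entry(3)[of a y] transpose_entry(3)[of a z]
      ax a lt dist by auto
  have yx: "b y x = \<omega>\<^sup>2" "b z y = \<omega>\<^sup>2" "b z x = \<omega>"
    using transpose_entry(3)[of x y] transpose_entry(3)[of y z] transpose_entry(2)[of x z]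
      xy yz xz lt d by auto
  have rules: "b u (partner v) = b v u" "b (partner v) u = b u v" "b (partner u) (partner v) = b u v"
    if "u \<in> {a, x, y, z}" "v \<in> {a, x, y, z}" "u \<noteq> v" for u v
    using that partner_rules[of v u] partner_rules[of u v] dist a lt nz by auto
  have row: "b 0 a = 1" "b 0 (partner a) = 1" "b 0 x = 1" "b 0 y = 1" "b 0 z = 1"
    "b 0 (partner x) = 1" "b 0 (partner y) = 1" "b 0 (partner z) = 1"
    using a lt nz partner(1,2) first_row by simp_all
  have na: "a \<noteq> x" "a \<noteq> y" "a \<noteq> z" using dist by auto
  have mixed:
    "b a (partner x) = \<omega>\<^sup>2" "b a (partner y) = \<omega>\<^sup>2" "b a (partner z) = \<omega>\<^sup>2"
    "b (partner a) x = \<omega>\<^sup>2" "b (partner a) y = \<omega>\<^sup>2" "b (partner a) z = \<omega>\<^sup>2"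
    "b (partner a) (partner x) = \<omega>" "b (partner a) (partner y) = \<omega>" "b (partner a) (partner z) = \<omega>"
    "b x (partner y) = \<omega>\<^sup>2" "b x (partner z) = \<omega>" "b y (partner x) = \<omega>"
    "b y (partner z) = \<omega>\<^sup>2" "b z (partner x) = \<omega>\<^sup>2" "b z (partner y) = \<omega>"
    "b (partner x) (partner z) = \<omega>\<^sup>2" "b (partner x) (partner y) = \<omega>"
    "b (partner z) (partner y) = \<omega>\<^sup>2"
    using [[linarith_neq_limit = 0]] d na by (simp_all add: rules ax xa xy yz xz yx)
  have upper: "Q9 $$ (i, j) = b (l ! i) (l ! j)" if "i < 9" "j < 9" "i < j" for i j
    using that unfolding l_def
    by (simp add: Q9_def mat_of_rows_list_def numeral_eq_Suc less_Suc_eq)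
      (elim disjE conjE; simp add: row inner ax xy yz xz mixed power2_eq_square[symmetric]
        flip: numeral_2_eq_2)
  show "Q9 $$ (i, j) = b (l ! i) (l ! j)" if ij: "i < 9" "j < 9" for i j
  proof -
    have "length l = 9" by (simp add: l_def)
    then have lt: "l ! i < 9" "l ! j < 9"
      using sub[THEN subsetD, OF nth_mem] ij by (simp_all only: lessThan_iff)
    consider "i < j" | "i = j" | "j < i" by linarith
    then show ?thesis
    proof cases
      case 3
      then show ?thesis
        using upper[OF ij(2,1)] Q9_hermitian[OF ij] hermitian[OF lt(2,1)] by simp
    qed (use upper ij Q9_diag diag lt in auto)
  qed
qed

text \<open>The index 1 serves as \<open>a\<close>. Exactly one of \<open>b x y\<close> and
  \<open>b x z\<close> is \<omega>; in the second case \<open>y\<close> and \<open>z\<close>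
  exchange roles.\<close>

lemma ex_enumeration:
  obtains l where "distinct l" "set l = {..<9}"
    "\<And>i j. i < 9 \<Longrightarrow> j < 9 \<Longrightarrow> Q9 $$ (i, j) = b (l ! i) (l ! j)"
proof -
  have "k \<noteq> 0 \<and> k \<noteq> 1" if "b 1 k = \<omega>" for k
    using that diag[of 1] first_col[of 1] omega_neq by (intro conjI notI) auto
  \<comment> \<open>For the pair 1, 0 the triple product is just \<open>b 1 k\<close>, so
    \<open>products\<close> counts the \<omega>s in row 1.\<close>
  then have "{k. k < 9 \<and> b 1 k = \<omega>} = {k \<in> {..<9} - {1, 0}. b 1 k * b k 0 * b 0 1 = \<omega>}"
    by (auto simp: first_row first_col)
  then have "card {k. k < 9 \<and> b 1 k = \<omega>} = 3"
    using products(2)[of 1 0] by simp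
  then obtain x y z where out: "{k. k < 9 \<and> b 1 k = \<omega>} = {x, y, z}"
    and d: "x \<noteq> y" "x \<noteq> z" "y \<noteq> z"
    by (auto simp: card_3_iff)
  have lt: "x < 9" "y < 9" "z < 9" using out by blast+
  have out': "{k. k < 9 \<and> b 1 k = \<omega>} = {x, z, y}" using out by auto
  have dist: "distinct [0, 1, partner 1, x, y, z, partner x, partner z, partner y]"
    and third: "b x y = \<omega>\<^sup>2 \<longleftrightarrow> b x z \<noteq> \<omega>\<^sup>2"
    using out_neighbours[OF _ _ lt d out] by simp_all
  have "x \<noteq> 0" "y \<noteq> 0" "z \<noteq> 0" "partner x \<noteq> y" "partner x \<noteq> z"
    using dist by auto
  then have "b x y \<noteq> 1" "b x z \<noteq> 1"
    using partner_eqI[of x y] partner_eqI[of x z] lt d by metis+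
  then have "b x y = \<omega> \<or> b x z = \<omega>"
    using third entry[of x y] entry[of x z] lt d by blast
  then show thesis
  proof
    assume "b x y = \<omega>"
    then show thesis
      using cyclic_triple_enumeration[OF _ _ lt d out] by (intro that) auto
  next
    assume "b x z = \<omega>"
    then show thesis
      using cyclic_triple_enumeration[OF _ _ lt(1,3,2) d(2,1) d(3)[symmetric] out']
      by (intro that) auto
  qed
qed

end

section \<open>Normalising and switching an arbitrary matrix\<close>

lemma switching_equivalent_Q9:
  assumes A: "nontrivial_cube_root_signature_matrix_of_frame 9 6 A"
  shows "switching_equivalent 9 A Q9"
proof -
  have sig: "signature_matrix_of_frame 9 6 A" and cr: "cube_root_seidel_matrix 9 A"
    using A by (auto simp: nontrivial_cube_root_signature_matrix_of_frame_def
        cube_root_signature_matrix_def)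
  have Ac: "A \<in> carrier_mat 9 9" and adj: "mat_adjoint A = A"
    and dg: "\<And>i. i < 9 \<Longrightarrow> A $$ (i, i) = 0"
    and cm: "\<And>i j. i < 9 \<Longrightarrow> j < 9 \<Longrightarrow> i \<noteq> j \<Longrightarrow> cmod (A $$ (i, j)) = 1"
    and cube: "\<And>i j. i < 9 \<Longrightarrow> j < 9 \<Longrightarrow> i \<noteq> j \<Longrightarrow> (A $$ (i, j)) ^ 3 = 1"
    using cr by (auto simp: cube_root_seidel_matrix_def seidel_matrix_def)
  have herm: "cnj (A $$ (i, j)) = A $$ (j, i)" if "i < 9" "j < 9" for i j
    using arg_cong[OF adj, of "\<lambda>M. M $$ (j, i)"] that Ac by (simp add: mat_adjoint_index)
  \<comment> \<open>Switching by the first row makes that row 1, as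
    \<open>A $$ (0, i) * cnj (d i) = 1\<close>. Index 0 is set apart because the diagonal entry 0 is
    not unimodular. The \<open>d i\<close> are cube roots of unity, so the entries stay cube
    roots.\<close>
  define d where "d i = (if i = 0 then 1 else A $$ (0, i))" for i
  have dm: "cmod (d i) = 1" if "i < 9" for i
    using cm[of 0 i] that by (simp add: d_def)
  then have dd: "d i * cnj (d i) = 1" "cnj (d i) * d i = 1" if "i < 9" for i
    using that by (simp_all add: of_real_cmod_sq[symmetric] mult.commute)
  have d3: "d i ^ 3 = 1" "cnj (d i) ^ 3 = 1" if "i < 9" for i
    using cube[of 0 i] that by (auto simp: d_def simp flip: complex_cnj_power)
  define b where "b i j = d i * A $$ (i, j) * cnj (d j)" for i j
  interpret standard_cube_root_signature b
  proof
    fix i j :: nat assume i: "i < 9"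
    show "b i i = 0" by (simp add: b_def dg i)
    show "b 0 i = 1" if "i \<noteq> 0"
      using dd(1)[OF i] that by (simp add: b_def d_def)
    assume j: "j < 9"
    show "cnj (b i j) = b j i"
      by (simp add: b_def herm i j mult_ac)
    assume ij: "i \<noteq> j"
    show "b i j \<in> {1, \<omega>, \<omega>\<^sup>2}"
      using cube[OF i j ij] d3 i j
      by (simp only: b_def cube_root_of_unity_iff[symmetric] power_mult_distrib mult_1)
    have "(\<Sum>k<9. A $$ (i, k) * A $$ (k, j)) = - 2 * A $$ (i, j)"
      using arg_cong[OF signature_matrix_square[OF sig], of "\<lambda>M. M $$ (i, j)"] Ac i j ij
      by (simp add: scalar_prod_def lessThan_atLeast0)
    \<comment> \<open>The inner factors \<open>cnj (d k)\<close> and \<open>d k\<close> cancel, so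
      the quadratic equation survives the switching.\<close>
    moreover have "(\<Sum>k<9. b i k * b k j) = d i * cnj (d j) * (\<Sum>k<9. A $$ (i, k) * A $$ (k, j))"
      unfolding sum_distrib_left
    proof (rule sum.cong[OF refl])
      fix k :: nat assume "k \<in> {..<9}"
      have "b i k * b k j = d i * cnj (d j) * (A $$ (i, k) * A $$ (k, j)) * (d k * cnj (d k))"
        by (simp add: b_def mult_ac)
      then show "b i k * b k j = d i * cnj (d j) * (A $$ (i, k) * A $$ (k, j))"
        using dd \<open>k \<in> {..<9}\<close> by simp
    qed
    ultimately show "(\<Sum>k<9. b i k * b k j) = - 2 * b i j"
      by (simp add: b_def)
  qed
  obtain l where l: "distinct l" "set l = {..<9}"
    and Q: "\<And>i j. i < 9 \<Longrightarrow> j < 9 \<Longrightarrow> Q9 $$ (i, j) = b (l ! i) (l ! j)"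
    using ex_enumeration by blast
  have "length l = 9" using distinct_card[OF l(1)] l(2) by simp
  then have "(\<lambda>i. if i < 9 then l ! i else i) permutes {..<9}"
    using nth_permutes[of l] l by simp
  then show ?thesis
    by (intro switching_equivalentI[where d = d and q = "\<lambda>i. if i < 9 then l ! i else i"])
      (simp_all add: Ac Q9_carrier dm Q b_def)
qed

theorem theorem6p1:
  shows "nontrivial_cube_root_signature_matrix_of_frame 9 6 Q9 \<and>
    (\<forall>A. nontrivial_cube_root_signature_matrix_of_frame 9 6 A \<longrightarrow>
         switching_equivalent 9 A Q9)"
  using Q9_nontrivial_cube_root_signature_matrix switching_equivalent_Q9 by blast

end
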